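(* Let $n\ge1$ and let $(\xi_i,\mathcal{F}_i)_{i=0,\dots,n}$ be real-valued supermartingale differences with $S_k=\sum_{i=1}^k\xi_i$ and quadratic characteristic $\langle S\rangle_k=\sum_{i=1}^k\mathbf{E}(\xi_i^2|\mathcal{F}_{i-1})$. Assume that, for a constant $\epsilon\in(0,\infty)$, $$\mathbf{E}(\xi_i^l|\mathcal{F}_{i-1})\le\frac12\,l!\,\epsilon^{l-2}\,\mathbf{E}(\xi_i^2|\mathcal{F}_{i-1})\quad\text{a.s. for all integers } l\ge2\ \text{and all } i\in[1,n].$$ Then, for all $x,v>0$, $$\mathbf{P}\left(S_k\ge x\ \text{and}\ \langle S\rangle_k\le v^2\ \text{for some}\ k\in[1,n]\right)\le B_{1,n}(x,\epsilon,v)\le B_1(x,\epsilon,v),$$ where $$B_{1,n}(x,\epsilon,v):=\exp\left\{-\overline{\lambda}x+n\log\left(1+\frac{\overline{\lambda}^2v^2}{2n(1-\overline{\lambda}\epsilon)}\right)\right\},\qquad \overline{\lambda}=\frac{2x/v^2}{2x\epsilon/v^2+1+\sqrt{1+2x\epsilon/v^2}}\in(0,\epsilon^{-1}).$$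
   Context: $(\xi_i,\mathcal{F}_i)_{i=0,\dots,n}$ is a sequence of real-valued supermartingale differences on a probability space $(\Omega,\mathcal{F},\mathbf{P})$: $\xi_0=0$, $\{\emptyset,\Omega\}=\mathcal{F}_0\subseteq\dots\subseteq\mathcal{F}_n\subseteq\mathcal{F}$ are increasing $\sigma$-fields, $\xi_i$ is $\mathcal{F}_i$-measurable, and $\mathbf{E}(\xi_i|\mathcal{F}_{i-1})\le 0$ for $i=1,\dots,n$. Here $i,k\in[1,n]$ denote integers. For $x,\epsilon,v>0$, $$B_1(x,\epsilon,v)=\exp\left\{-\frac{x^2}{v^2\left(1+\sqrt{1+2x\epsilon/v^2}\right)+x\epsilon}\right\}.$$ *)

theory Defs
  imports "HOL-Probability.Probability"
begin

text \<open>
  Conditional expectation with values in the extended reals: the defining formula of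
  \<^const>\<open>real_cond_exp\<close> with \<^const>\<open>enn2ereal\<close> in place of \<^const>\<open>enn2real\<close>.
  \<^const>\<open>real_cond_exp\<close> replaces an infinite conditional moment by 0, so a moment bound
  stated with it would say nothing for powers that are not integrable. The indeterminate case
  \<open>\<infinity> - \<infinity>\<close> evaluates to \<open>\<infinity>\<close> on \<^typ>\<open>ereal\<close>, so an upper bound on a conditional moment
  that does not exist can only hold where the bound itself is infinite.
\<close>

definition ext_cond_exp :: "'a measure \<Rightarrow> 'a measure \<Rightarrow> ('a \<Rightarrow> real) \<Rightarrow> 'a \<Rightarrow> ereal" where
  "ext_cond_exp M F f \<omega> =
     enn2ereal (nn_cond_exp M F (\<lambda>\<omega>. ennreal (f \<omega>)) \<omega>)
   - enn2ereal (nn_cond_exp M F (\<lambda>\<omega>. ennreal (- f \<omega>)) \<omega>)"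

lemma (in sigma_finite_subalgebra) ext_cond_exp_eq_real_cond_exp:
  assumes "integrable M f"
  shows "AE \<omega> in M. ext_cond_exp M F f \<omega> = ereal (real_cond_exp M F f \<omega>)"
proof -
  have fin: "AE \<omega> in M. nn_cond_exp M F (\<lambda>\<omega>. ennreal (g \<omega>)) \<omega> \<noteq> \<infinity>"
    if g: "integrable M g" for g :: "'a \<Rightarrow> real"
  proof (rule nn_integral_noteq_infinite)
    have "(\<integral>\<^sup>+ \<omega>. nn_cond_exp M F (\<lambda>\<omega>. ennreal (g \<omega>)) \<omega> \<partial>M) = (\<integral>\<^sup>+ \<omega>. ennreal (g \<omega>) \<partial>M)"
      using g nn_cond_exp_intg[of "\<lambda>_. 1" "\<lambda>\<omega>. ennreal (g \<omega>)"] by simp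
    also have "\<dots> \<noteq> \<infinity>"
      using g by (simp add: real_integrable_def)
    finally show "(\<integral>\<^sup>+ \<omega>. nn_cond_exp M F (\<lambda>\<omega>. ennreal (g \<omega>)) \<omega> \<partial>M) \<noteq> \<infinity>" .
  qed simp
  have conv: "enn2ereal a = ereal (enn2real a)" if "a \<noteq> \<infinity>" for a
    using that by (cases a) auto
  have "integrable M (\<lambda>\<omega>. - f \<omega>)"
    using assms by simp
  from fin[OF assms] fin[OF this] show ?thesis
    by eventually_elim (simp add: ext_cond_exp_def real_cond_exp_def conv)
qed

lemma (in sigma_finite_subalgebra) ext_cond_exp_nonneg:
  assumes "\<And>\<omega>. 0 \<le> f \<omega>" and "f \<in> borel_measurable M"
  shows "AE \<omega> in M. ext_cond_exp M F f \<omega> = enn2ereal (nn_cond_exp M F (\<lambda>\<omega>. ennreal (f \<omega>)) \<omega>)"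
proof -
  have "(\<lambda>\<omega>. ennreal (- f \<omega>)) = (\<lambda>_. 0)"
    using assms(1) by (auto simp: ennreal_neg)
  moreover have "AE \<omega> in M. 0 = nn_cond_exp M F (\<lambda>_. 0) \<omega>"
    by (rule nn_cond_exp_F_meas) simp
  ultimately have "AE \<omega> in M. nn_cond_exp M F (\<lambda>\<omega>. ennreal (- f \<omega>)) \<omega> = 0"
    by auto
  then show ?thesis
    by eventually_elim (simp add: ext_cond_exp_def zero_ennreal.rep_eq)
qed

definition supermartingale_differences ::
    "'a measure \<Rightarrow> nat \<Rightarrow> (nat \<Rightarrow> 'a measure) \<Rightarrow> (nat \<Rightarrow> 'a \<Rightarrow> real) \<Rightarrow> bool" where
  "supermartingale_differences M n F \<xi> \<longleftrightarrow>
     (\<forall>\<omega>\<in>space M. \<xi> 0 \<omega> = 0) \<and>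
     sets (F 0) = {{}, space M} \<and>
     (\<forall>i\<le>n. subalgebra M (F i)) \<and>
     (\<forall>i<n. sets (F i) \<subseteq> sets (F (Suc i))) \<and>
     (\<forall>i\<le>n. \<xi> i \<in> borel_measurable (F i)) \<and>
     (\<forall>i\<in>{1..n}. integrable M (\<xi> i)) \<and>
     (\<forall>i\<in>{1..n}. AE \<omega> in M. real_cond_exp M (F (i - 1)) (\<xi> i) \<omega> \<le> 0)"

definition partial_sum :: "(nat \<Rightarrow> 'a \<Rightarrow> real) \<Rightarrow> nat \<Rightarrow> 'a \<Rightarrow> real" where
  "partial_sum \<xi> k \<omega> = (\<Sum>i=1..k. \<xi> i \<omega>)"

definition quadratic_characteristic ::
    "'a measure \<Rightarrow> (nat \<Rightarrow> 'a measure) \<Rightarrow> (nat \<Rightarrow> 'a \<Rightarrow> real) \<Rightarrow> nat \<Rightarrow> 'a \<Rightarrow> ereal" where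
  "quadratic_characteristic M F \<xi> k \<omega> =
     (\<Sum>i=1..k. ext_cond_exp M (F (i - 1)) (\<lambda>\<omega>. (\<xi> i \<omega>)\<^sup>2) \<omega>)"

definition B1 :: "real \<Rightarrow> real \<Rightarrow> real \<Rightarrow> real" where
  "B1 x \<epsilon> v = exp (- (x\<^sup>2 / (v\<^sup>2 * (1 + sqrt (1 + 2 * x * \<epsilon> / v\<^sup>2)) + x * \<epsilon>)))"

definition lambda_bar :: "real \<Rightarrow> real \<Rightarrow> real \<Rightarrow> real" where
  "lambda_bar x \<epsilon> v =
     (2 * x / v\<^sup>2) / (2 * x * \<epsilon> / v\<^sup>2 + 1 + sqrt (1 + 2 * x * \<epsilon> / v\<^sup>2))"

definition B1n :: "nat \<Rightarrow> real \<Rightarrow> real \<Rightarrow> real \<Rightarrow> real" where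
  "B1n n x \<epsilon> v =
     (let L = lambda_bar x \<epsilon> v
      in exp (- L * x + real n * ln (1 + L\<^sup>2 * v\<^sup>2 / (2 * real n * (1 - L * \<epsilon>)))))"

end

theory Submission
  imports Defs
begin

text \<open>
  Bernstein's condition gives
  \<open>E(exp(\<lambda> \<xi>\<^sub>i) | F\<^sub>i\<^sub>-\<^sub>1) \<le> 1 + f V\<^sub>i\<close> with \<open>f = \<lambda>\<^sup>2 / (2 (1 - \<lambda> \<epsilon>))\<close> and
  \<open>V\<^sub>i = E(\<xi>\<^sub>i\<^sup>2 | F\<^sub>i\<^sub>-\<^sub>1)\<close>, so the products of \<open>exp(\<lambda> \<xi>\<^sub>i) / (1 + f V\<^sub>i)\<close>, killed as soon
  as \<open>V\<^sub>1 + \<dots> + V\<^sub>k\<close> exceeds \<open>v\<^sup>2\<close>, form a nonnegative supermartingale. On the event at time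
  \<open>k\<close> the denominators multiply to at most \<open>(1 + f v\<^sup>2 / n)\<^sup>n\<close> by the inequality of
  arithmetic and geometric means, and the maximal inequality yields the bound for every
  \<open>\<lambda> \<in> (0, 1 / \<epsilon>)\<close>. The choice \<open>\<lambda> = \<lambda>bar\<close> gives the claim, and \<open>ln (1 + t) \<le> t\<close> the
  weaker bound. Since \<open>\<xi>\<^sub>i\<^sup>2\<close> need not be integrable, moments are only taken against
  \<open>F\<^sub>i\<^sub>-\<^sub>1\<close>-measurable weights \<open>W\<close> that make \<open>W V\<^sub>i\<close> integrable.
\<close>

text \<open>The exponential series is integrated term by term: the factorials cancel and a geometric
  series of ratio \<open>l * \<epsilon>\<close> remains. The hypotheses compare integrals of
  positive and negative parts because integrability of the powers is not given; it is derived from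
  them.\<close>

lemma exp_moment_le_of_power_moments:
  fixes X :: "'a \<Rightarrow> real" and q l \<epsilon> :: real
  assumes "finite_measure M" and X[measurable]: "X \<in> borel_measurable M"
    and \<epsilon>: "\<epsilon> > 0" and l: "l > 0" "l * \<epsilon> < 1" and q: "q \<ge> 0"
    and first: "(\<integral>\<^sup>+\<omega>. ennreal (X \<omega>) \<partial>M) \<le> (\<integral>\<^sup>+\<omega>. ennreal (- X \<omega>) \<partial>M)"
    and moments: "\<And>k. k \<ge> 2 \<Longrightarrow> (\<integral>\<^sup>+\<omega>. ennreal (X \<omega> ^ k) \<partial>M)
      \<le> ennreal (fact k / 2 * \<epsilon> ^ (k - 2) * q) + (\<integral>\<^sup>+\<omega>. ennreal (- (X \<omega> ^ k)) \<partial>M)"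
  shows "(\<integral>\<^sup>+\<omega>. ennreal (exp (l * X \<omega>)) \<partial>M)
    \<le> ennreal (measure M (space M) + l\<^sup>2 / (2 * (1 - l * \<epsilon>)) * q)"
proof -
  interpret finite_measure M by fact
  define m where "m = measure M (space M)"
  have m0: "m \<ge> 0" by (simp add: m_def)
  define r where "r = l * \<epsilon>"
  have r: "0 < r" "r < 1" using \<epsilon> l by (auto simp: r_def)
  \<comment> \<open>For an even power the negative part vanishes, so the moment bound itself forces
    finiteness; odd powers are then dominated by the next even one.\<close>
  have int_even: "integrable M (\<lambda>\<omega>. X \<omega> ^ k)" if "even k" for k
  proof (cases "k = 0")
    case False
    with that have k2: "k \<ge> 2" by (auto elim!: evenE)
    have "(\<integral>\<^sup>+\<omega>. ennreal (- (X \<omega> ^ k)) \<partial>M) = 0"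
      using that by (simp add: ennreal_neg zero_le_even_power)
    with moments[OF k2] have "(\<integral>\<^sup>+\<omega>. ennreal (X \<omega> ^ k) \<partial>M) < \<infinity>"
      by (simp add: order.strict_trans1)
    with that show ?thesis
      by (intro integrableI_nonneg) (auto simp: zero_le_even_power)
  qed simp
  have int: "integrable M (\<lambda>\<omega>. X \<omega> ^ k)" for k
  proof (cases "even k")
    case False
    have "integrable M (\<lambda>\<omega>. 1 + X \<omega> ^ Suc k)"
      using False by (intro Bochner_Integration.integrable_add int_even) auto
    then show ?thesis
    proof (rule Bochner_Integration.integrable_bound, goal_cases)
      case 2
      have "\<bar>y\<bar> ^ k \<le> 1 + y ^ Suc k" for y :: real
      proof (cases "\<bar>y\<bar> \<le> 1")
        case True
        then have "\<bar>y\<bar> ^ k \<le> 1" by (simp add: power_le_one)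
        moreover have "0 \<le> y ^ Suc k" using False by (intro zero_le_even_power) auto
        ultimately show ?thesis by linarith
      next
        case f: False
        then have "\<bar>y\<bar> ^ k \<le> \<bar>y\<bar> ^ Suc k" by (intro power_increasing) auto
        also have "\<dots> = y ^ Suc k" using False by (intro power_even_abs) auto
        finally show ?thesis by simp
      qed
      then show ?case by (auto simp: power_abs intro!: AE_I2 order_trans[OF _ abs_ge_self])
    qed simp
  qed (rule int_even)
  have le_of_nn: "integral\<^sup>L M Y \<le> c"
    if Y: "integrable M Y" and c: "c \<ge> 0"
      and le: "(\<integral>\<^sup>+\<omega>. ennreal (Y \<omega>) \<partial>M) \<le> ennreal c + (\<integral>\<^sup>+\<omega>. ennreal (- Y \<omega>) \<partial>M)" for Y c
  proof -
    have fin: "(\<integral>\<^sup>+\<omega>. ennreal (- Y \<omega>) \<partial>M) < \<infinity>"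
      using Y by (auto simp: real_integrable_def less_top)
    have "enn2real (\<integral>\<^sup>+\<omega>. ennreal (Y \<omega>) \<partial>M) \<le> enn2real (ennreal c + (\<integral>\<^sup>+\<omega>. ennreal (- Y \<omega>) \<partial>M))"
      using fin by (intro enn2real_mono le) auto
    also have "\<dots> = c + enn2real (\<integral>\<^sup>+\<omega>. ennreal (- Y \<omega>) \<partial>M)"
      using fin c by (subst enn2real_plus) auto
    finally show ?thesis using real_lebesgue_integral_def[OF Y] by simp
  qed
  \<comment> \<open>Bounds for the integrated terms: the total mass for \<open>k = 0\<close>, zero
    for \<open>k = 1\<close> because the mean is nonpositive and \<open>l > 0\<close>, and a
    geometric tail.\<close>
  define a where "a k = (if k = 0 then m else if k = 1 then 0 else l\<^sup>2 * q / 2 * r ^ (k - 2))" for k :: nat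
  have term_le: "(\<integral>\<omega>. (l * X \<omega>) ^ k / fact k \<partial>M) \<le> a k" for k
  proof -
    consider "k = 0" | "k = 1" | "k \<ge> 2" by linarith
    then show ?thesis
    proof cases
      case 1 then show ?thesis by (simp add: a_def m_def)
    next
      case 2
      have "integral\<^sup>L M X \<le> 0" using le_of_nn[of X 0] int[of 1] first by simp
      with 2 show ?thesis using l by (simp add: a_def mult_nonneg_nonpos)
    next
      case 3
      have "(\<integral>\<omega>. (l * X \<omega>) ^ k / fact k \<partial>M) = l ^ k / fact k * (\<integral>\<omega>. X \<omega> ^ k \<partial>M)"
        by (simp add: power_mult_distrib)
      also have "\<dots> \<le> l ^ k / fact k * (fact k / 2 * \<epsilon> ^ (k - 2) * q)"
        using q \<epsilon> l by (intro mult_left_mono le_of_nn int moments 3) auto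
      also have "\<dots> = a k"
      proof -
        have "l ^ k = l\<^sup>2 * l ^ (k - 2)" using 3 by (metis le_add_diff_inverse power_add)
        then show ?thesis using 3 by (simp add: a_def r_def power_mult_distrib)
      qed
      finally show ?thesis .
    qed
  qed
  have a0: "a k \<ge> 0" for k using m0 q r by (auto simp: a_def)
  have "(\<lambda>k. a (Suc (Suc k))) sums (l\<^sup>2 * q / 2 * (1 / (1 - r)))"
    using sums_mult[OF geometric_sums[of r], of "l\<^sup>2 * q / 2"] r by (simp add: a_def)
  then have "(\<lambda>k. a (Suc k)) sums (l\<^sup>2 * q / 2 * (1 / (1 - r)) + a (Suc 0))"
    by (subst (asm) sums_Suc_iff) simp
  then have a_sums: "a sums (m + l\<^sup>2 / (2 * (1 - l * \<epsilon>)) * q)"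
    by (subst (asm) sums_Suc_iff) (simp add: a_def r_def algebra_simps)
  \<comment> \<open>Summing only the even moments shows that \<open>cosh\<close> is integrable; it dominates the partial
    sums of the exponential series, whose odd terms have no absolute moment bound.\<close>
  define g where "g k \<omega> = (if even k then (l * X \<omega>) ^ k / fact k else 0)" for k \<omega>
  have g0: "g k \<omega> \<ge> 0" for k \<omega> by (auto simp: g_def zero_le_even_power)
  have g_sums: "(\<lambda>k. g k \<omega>) sums cosh (l * X \<omega>)" for \<omega>
    using cosh_converges[of "l * X \<omega>"] by (simp add: g_def divide_inverse mult.commute cong: if_cong)
  have g_int: "integrable M (g k)" for k
    unfolding g_def using int[of k] by (cases "even k") (auto simp: power_mult_distrib)
  have "integrable M (\<lambda>\<omega>. \<Sum>k. g k \<omega>)"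
  proof (rule integrable_suminf[OF g_int])
    show "AE \<omega> in M. summable (\<lambda>k. norm (g k \<omega>))"
      using sums_summable[OF g_sums] g0 by simp
    show "summable (\<lambda>k. \<integral>\<omega>. norm (g k \<omega>) \<partial>M)"
    proof (rule summable_comparison_test')
      show "summable a" using a_sums by (rule sums_summable)
      fix k show "norm (\<integral>\<omega>. norm (g k \<omega>) \<partial>M) \<le> a k"
        using term_le[of k] a0[of k] g0 by (cases "even k") (simp_all add: g_def zero_le_even_power)
    qed
  qed
  then have int_cosh: "integrable M (\<lambda>\<omega>. 2 * cosh (l * X \<omega>))"
    using sums_unique[OF g_sums] by simp
  define s where "s N \<omega> = (\<Sum>k<N. (l * X \<omega>) ^ k / fact k)" for N \<omega>
  have s_lim: "(\<lambda>N. s N \<omega>) \<longlonglongrightarrow> exp (l * X \<omega>)" for \<omega>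
    using exp_converges[of "l * X \<omega>"] by (simp add: s_def sums_def divide_inverse mult.commute)
  have exp_le: "exp \<bar>y\<bar> \<le> 2 * cosh y" for y :: real
    by (simp add: cosh_def abs_if)
  have s_bd: "norm (s N \<omega>) \<le> 2 * cosh (l * X \<omega>)" for N \<omega>
  proof -
    have "norm (s N \<omega>) \<le> (\<Sum>k<N. \<bar>l * X \<omega>\<bar> ^ k / fact k)"
      unfolding s_def by (rule order_trans[OF norm_sum]) (simp add: power_abs)
    also have "\<dots> \<le> exp \<bar>l * X \<omega>\<bar>"
      using exp_converges[of "\<bar>l * X \<omega>\<bar>"]
      by (intro sum_le_suminf[of "\<lambda>k. \<bar>l * X \<omega>\<bar> ^ k / fact k", THEN order_trans])
         (auto simp: sums_iff divide_inverse mult.commute)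
    finally show ?thesis using exp_le by (rule order_trans)
  qed
  have s_meas[measurable]: "s N \<in> borel_measurable M" for N unfolding s_def by measurable
  have dc: "integrable M (\<lambda>\<omega>. exp (l * X \<omega>))"
    "(\<lambda>N. integral\<^sup>L M (s N)) \<longlonglongrightarrow> (\<integral>\<omega>. exp (l * X \<omega>) \<partial>M)"
    using s_lim s_bd
    by (auto intro!: integrable_dominated_convergence[where s = s, OF _ _ int_cosh]
        integral_dominated_convergence[OF _ _ int_cosh])
  have "integral\<^sup>L M (s N) \<le> m + l\<^sup>2 / (2 * (1 - l * \<epsilon>)) * q" for N
  proof -
    have "integral\<^sup>L M (s N) = (\<Sum>k<N. \<integral>\<omega>. (l * X \<omega>) ^ k / fact k \<partial>M)"
      unfolding s_def using int by (intro Bochner_Integration.integral_sum) (auto simp: power_mult_distrib)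
    also have "\<dots> \<le> (\<Sum>k<N. a k)" by (intro sum_mono term_le)
    also have "\<dots> \<le> suminf a" using a_sums a0 by (intro sum_le_suminf) (auto simp: sums_iff)
    finally show ?thesis using a_sums by (simp add: sums_iff)
  qed
  with dc(2) have "(\<integral>\<omega>. exp (l * X \<omega>) \<partial>M) \<le> m + l\<^sup>2 / (2 * (1 - l * \<epsilon>)) * q"
    by (intro LIMSEQ_le_const2) auto
  then show ?thesis
    using dc(1) by (subst nn_integral_eq_integral) (auto simp: m_def intro: ennreal_leI)
qed

text \<open>This is the unconditional estimate on the measure \<open>density M W\<close>: as
  \<open>W\<close> is \<open>F\<close>-measurable, conditional moments may replace the powers of
  \<open>X\<close> under the weighted integral. The two finiteness hypotheses make this measure and
  the second moment of \<open>X\<close> under it finite.\<close>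

lemma (in sigma_finite_subalgebra) nn_integral_exp_le_of_cond_moments:
  fixes X :: "'a \<Rightarrow> real" and l \<epsilon> :: real
  defines "V \<equiv> nn_cond_exp M F (\<lambda>\<omega>. ennreal ((X \<omega>)\<^sup>2))"
  assumes X: "integrable M X" and \<epsilon>: "\<epsilon> > 0" and l: "l > 0" "l * \<epsilon> < 1"
    and first: "AE \<omega> in M. real_cond_exp M F X \<omega> \<le> 0"
    and moments: "\<And>k. k \<ge> 2 \<Longrightarrow> AE \<omega> in M. ext_cond_exp M F (\<lambda>\<omega>. X \<omega> ^ k) \<omega>
      \<le> ereal (1 / 2 * fact k * \<epsilon> ^ (k - 2)) * ext_cond_exp M F (\<lambda>\<omega>. (X \<omega>)\<^sup>2) \<omega>"
    and W[measurable]: "W \<in> borel_measurable F"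
    and fin: "(\<integral>\<^sup>+\<omega>. W \<omega> \<partial>M) < \<infinity>" "(\<integral>\<^sup>+\<omega>. W \<omega> * V \<omega> \<partial>M) < \<infinity>"
  shows "(\<integral>\<^sup>+\<omega>. W \<omega> * ennreal (exp (l * X \<omega>)) \<partial>M)
    \<le> (\<integral>\<^sup>+\<omega>. W \<omega> * (1 + ennreal (l\<^sup>2 / (2 * (1 - l * \<epsilon>))) * V \<omega>) \<partial>M)"
proof -
  have [measurable]: "X \<in> borel_measurable M" using X by auto
  have WM[measurable]: "W \<in> borel_measurable M"
    by (rule measurable_from_subalg[OF subalg W])
  have [measurable]: "V \<in> borel_measurable M" unfolding V_def by simp
  define P where "P k = nn_cond_exp M F (\<lambda>\<omega>. ennreal (X \<omega> ^ k))" for k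
  define N where "N k = nn_cond_exp M F (\<lambda>\<omega>. ennreal (- (X \<omega> ^ k)))" for k
  have [measurable]: "P k \<in> borel_measurable M" "N k \<in> borel_measurable M" for k
    by (auto simp: P_def N_def)
  have Vnn: "AE \<omega> in M. ext_cond_exp M F (\<lambda>\<omega>. (X \<omega>)\<^sup>2) \<omega> = enn2ereal (V \<omega>)"
    unfolding V_def by (rule ext_cond_exp_nonneg) auto
  \<comment> \<open>Moving the negative part to the right-hand side avoids all case distinctions on infinite moments.\<close>
  have aux: "p \<le> ennreal c * w + n"
    if "c > 0" "enn2ereal p - enn2ereal n \<le> ereal c * enn2ereal w" for p n w :: ennreal and c :: real
  proof (cases "w = \<top> \<or> n = \<top>")
    case True then show ?thesis using that by (auto simp: ennreal_mult_top)
  next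
    case False
    then obtain w' n' where "w = ennreal w'" "n = ennreal n'" "w' \<ge> 0" "n' \<ge> 0"
      by (metis ennreal_cases)
    with that show ?thesis
      by (cases p) (auto simp: enn2ereal_ennreal ennreal_mult[symmetric] ennreal_plus[symmetric] simp del: ennreal_plus intro!: ennreal_leI)
  qed
  have cond: "AE \<omega> in M. P k \<omega> \<le> ennreal (fact k / 2 * \<epsilon> ^ (k - 2)) * V \<omega> + N k \<omega>" if "k \<ge> 2" for k
    using moments[OF that] Vnn
  proof eventually_elim
    case (elim \<omega>)
    then show ?case using \<epsilon> by (intro aux) (auto simp: ext_cond_exp_def P_def N_def)
  qed
  have cond1: "AE \<omega> in M. P 1 \<omega> \<le> N 1 \<omega>"
    using first ext_cond_exp_eq_real_cond_exp[OF X]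
  proof eventually_elim
    case (elim \<omega>)
    then have "ext_cond_exp M F X \<omega> \<le> 0" by simp
    \<comment> \<open>The first moment fits the pattern of \<open>aux\<close> with second-moment
      term 0 and constant 1.\<close>
    then have "enn2ereal (P 1 \<omega>) - enn2ereal (N 1 \<omega>) \<le> ereal 1 * enn2ereal 0"
      by (simp add: ext_cond_exp_def P_def N_def zero_ennreal.rep_eq)
    from aux[OF _ this] show ?case by simp
  qed
  have intP: "(\<integral>\<^sup>+\<omega>. ennreal (X \<omega> ^ k) \<partial>density M W) = (\<integral>\<^sup>+\<omega>. W \<omega> * P k \<omega> \<partial>M)"
    and intN: "(\<integral>\<^sup>+\<omega>. ennreal (- (X \<omega> ^ k)) \<partial>density M W) = (\<integral>\<^sup>+\<omega>. W \<omega> * N k \<omega> \<partial>M)" for k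
    unfolding P_def N_def by (simp_all add: nn_integral_density nn_cond_exp_intg)
  define q where "q = enn2real (\<integral>\<^sup>+\<omega>. W \<omega> * V \<omega> \<partial>M)"
  have q: "ennreal q = (\<integral>\<^sup>+\<omega>. W \<omega> * V \<omega> \<partial>M)" using fin by (simp add: q_def)
  have q0: "q \<ge> 0" by (simp add: q_def)
  have mass: "emeasure (density M W) (space M) = (\<integral>\<^sup>+\<omega>. W \<omega> \<partial>M)"
    by (simp add: emeasure_density cong: nn_integral_cong)
  interpret D: finite_measure "density M W"
    using fin mass by (intro finite_measureI) auto
  have "(\<integral>\<^sup>+\<omega>. ennreal (exp (l * X \<omega>)) \<partial>density M W)
    \<le> ennreal (measure (density M W) (space (density M W)) + l\<^sup>2 / (2 * (1 - l * \<epsilon>)) * q)"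
  proof (rule exp_moment_le_of_power_moments)
    show "(\<integral>\<^sup>+\<omega>. ennreal (X \<omega>) \<partial>density M W) \<le> (\<integral>\<^sup>+\<omega>. ennreal (- X \<omega>) \<partial>density M W)"
      using intP[of 1] intN[of 1] cond1
      by (auto intro!: nn_integral_mono_AE mult_left_mono elim!: eventually_mono)
    fix k :: nat assume k: "k \<ge> 2"
    define c where "c = fact k / 2 * \<epsilon> ^ (k - 2)"
    have c: "c \<ge> 0" using \<epsilon> by (simp add: c_def)
    have "(\<integral>\<^sup>+\<omega>. W \<omega> * P k \<omega> \<partial>M) \<le> (\<integral>\<^sup>+\<omega>. ennreal c * (W \<omega> * V \<omega>) + W \<omega> * N k \<omega> \<partial>M)"
    proof (rule nn_integral_mono_AE)
      show "AE \<omega> in M. W \<omega> * P k \<omega> \<le> ennreal c * (W \<omega> * V \<omega>) + W \<omega> * N k \<omega>"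
        using cond[OF k] unfolding c_def[symmetric]
      proof eventually_elim
        case (elim \<omega>)
        from mult_left_mono[OF this, of "W \<omega>"] show ?case by (simp add: algebra_simps)
      qed
    qed
    also have "\<dots> = ennreal (c * q) + (\<integral>\<^sup>+\<omega>. W \<omega> * N k \<omega> \<partial>M)"
      using c q0 by (subst nn_integral_add) (simp_all add: nn_integral_cmult ennreal_mult flip: q)
    finally show "(\<integral>\<^sup>+\<omega>. ennreal (X \<omega> ^ k) \<partial>density M W)
      \<le> ennreal (fact k / 2 * \<epsilon> ^ (k - 2) * q) + (\<integral>\<^sup>+\<omega>. ennreal (- (X \<omega> ^ k)) \<partial>density M W)"
      by (simp add: intP intN c_def)
  qed (use \<epsilon> l q0 in \<open>auto intro: D.finite_measure_axioms\<close>)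
  also have "\<dots> = (\<integral>\<^sup>+\<omega>. W \<omega> \<partial>M) + ennreal (l\<^sup>2 / (2 * (1 - l * \<epsilon>))) * (\<integral>\<^sup>+\<omega>. W \<omega> * V \<omega> \<partial>M)"
    using l q0 mass D.emeasure_eq_measure[of "space M"]
    by (subst ennreal_plus) (simp_all add: flip: q ennreal_mult)
  also have "\<dots> = (\<integral>\<^sup>+\<omega>. W \<omega> * (1 + ennreal (l\<^sup>2 / (2 * (1 - l * \<epsilon>))) * V \<omega>) \<partial>M)"
    by (simp add: nn_integral_add nn_integral_cmult[symmetric] distrib_left mult.left_commute del: nn_integral_cmult)
  finally show ?thesis by (simp add: nn_integral_density)
qed

text \<open>Exponential proof of the AM-GM inequality: with m = 1 + A / n, the bound t \<le> exp (t
  - 1) is applied to each t = (1 + a i) / m. When \<open>K\<close> has fewer than \<open>n\<close>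
  elements, each missing factor contributes exp (1 - 1 / m) \<le> m.\<close>

lemma prod_one_plus_le_power_mean:
  fixes a :: "'i \<Rightarrow> real" and n :: nat
  assumes a: "\<And>i. i \<in> K \<Longrightarrow> a i \<ge> 0" and "card K \<le> n" "n \<ge> 1" and A: "sum a K \<le> A"
  shows "(\<Prod>i\<in>K. 1 + a i) \<le> (1 + A / real n) ^ n"
proof -
  define m where "m = 1 + A / real n"
  have "A \<ge> 0" using sum_nonneg[of K a] a A by simp
  then have m: "m \<ge> 1" using \<open>n \<ge> 1\<close> by (simp add: m_def)
  have "(\<Prod>i\<in>K. 1 + a i) \<le> (\<Prod>i\<in>K. m * exp ((1 + a i) / m - 1))"
  proof (intro prod_mono conjI)
    fix i assume "i \<in> K"
    with a show "0 \<le> 1 + a i" by fastforce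
    show "1 + a i \<le> m * exp ((1 + a i) / m - 1)"
      using exp_ge_add_one_self[of "(1 + a i) / m - 1"] m by (simp add: field_simps)
  qed
  also have "\<dots> = m ^ card K * exp (sum a K / m - card K * (1 - 1 / m))"
  \<comment> \<open>For infinite \<open>K\<close> the products are 1 while the sum and the
    cardinality are 0, so both sides equal 1.\<close>
  proof (cases "finite K")
    case True
    then show ?thesis
      by (simp add: prod.distrib exp_sum[symmetric] sum.distrib sum_subtractf add_divide_distrib
          sum_divide_distrib algebra_simps)
  qed auto
  also have "\<dots> \<le> m ^ card K * exp ((n - card K) * (1 - 1 / m))"
  proof -
    have "sum a K / m \<le> A / m" using m A by (simp add: divide_right_mono)
    also have "A / m = n * (1 - 1 / m)" using m \<open>n \<ge> 1\<close> by (simp add: field_simps) (simp add: m_def field_simps)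
    finally show ?thesis using m \<open>card K \<le> n\<close> by (simp add: of_nat_diff algebra_simps)
  qed
  also have "\<dots> \<le> m ^ card K * m ^ (n - card K)"
  proof -
    have "1 - 1 / m \<le> ln m" using ln_le_minus_one[of "1 / m"] m by (simp add: ln_div)
    then have "exp (1 - 1 / m) \<le> m" using m by (metis exp_ln exp_le_cancel_iff less_le_trans zero_less_one)
    then show ?thesis using m by (simp add: exp_of_nat_mult power_mono)
  qed
  also have "\<dots> = m ^ n" using \<open>card K \<le> n\<close> by (simp flip: power_add)
  finally show ?thesis by (simp add: m_def)
qed

text \<open>\<open>lambda_bar\<close> minimises - l x + l^2 v^2 / (2 (1 - l \<epsilon>)) over 0 < l
  < 1 / \<epsilon>: the derivative vanishes exactly when 1 - l \<epsilon> = 1 / s, where s is the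
  square root in \<open>B1\<close>. Using s as the variable turns all claims into rational
  identities.\<close>

lemma lambda_bar_bounds_and_exponent:
  fixes x \<epsilon> v :: real
  assumes "x > 0" "\<epsilon> > 0" "v > 0"
  defines "l \<equiv> lambda_bar x \<epsilon> v"
  shows "l > 0" "l * \<epsilon> < 1"
    "- l * x + l\<^sup>2 * v\<^sup>2 / (2 * (1 - l * \<epsilon>))
      = - (x\<^sup>2 / (v\<^sup>2 * (1 + sqrt (1 + 2 * x * \<epsilon> / v\<^sup>2)) + x * \<epsilon>))"
proof -
  define s where "s = sqrt (1 + 2 * x * \<epsilon> / v\<^sup>2)"
  define u where "u = x / v\<^sup>2"
  have s1: "s > 1" using assms by (simp add: s_def)
  have u0: "u > 0" using assms by (simp add: u_def)
  have "s\<^sup>2 = 1 + 2 * x * \<epsilon> / v\<^sup>2"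
    using assms unfolding s_def by (intro real_sqrt_pow2 add_nonneg_nonneg) auto
  then have s2: "2 * x * \<epsilon> / v\<^sup>2 = s\<^sup>2 - 1" by simp
  then have ue: "2 * u * \<epsilon> = s\<^sup>2 - 1" by (simp add: u_def)
  have x: "x = u * v\<^sup>2" using assms by (simp add: u_def)
  have "l = 2 * u / (s\<^sup>2 - 1 + 1 + s)"
    unfolding l_def lambda_bar_def s_def[symmetric] unfolding s2 by (simp add: u_def)
  then have l: "l = 2 * u / (s * (s + 1))" by (simp add: power2_eq_square algebra_simps)
  show "l > 0" using l s1 u0 by simp
  have "l * \<epsilon> = (s\<^sup>2 - 1) / (s * (s + 1))" by (simp add: l ue)
  also have "\<dots> = 1 - 1 / s" using s1 by (simp add: divide_simps) (simp add: power2_eq_square algebra_simps)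
  finally have le: "l * \<epsilon> = 1 - 1 / s" .
  then show "l * \<epsilon> < 1" using s1 by simp
  have xe: "x * \<epsilon> = v\<^sup>2 * (s\<^sup>2 - 1) / 2" unfolding ue[symmetric] by (simp add: x)
  have "- l * x + l\<^sup>2 * v\<^sup>2 / (2 * (1 - l * \<epsilon>)) = - (2 * u\<^sup>2 * v\<^sup>2 / (s + 1)\<^sup>2)"
    unfolding le unfolding l x using s1
    by (simp add: divide_simps) (simp add: power2_eq_square algebra_simps)
  \<comment> \<open>Inserting x \<epsilon> = v^2 (s^2 - 1) / 2 makes the denominator of
    \<open>B1\<close> equal to v^2 (s + 1)^2 / 2.\<close>
  also have "2 * u\<^sup>2 * v\<^sup>2 / (s + 1)\<^sup>2 = x\<^sup>2 / (v\<^sup>2 * (1 + s) + x * \<epsilon>)"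
  proof -
    have "v\<^sup>2 * (1 + s) + x * \<epsilon> = v\<^sup>2 * (s + 1)\<^sup>2 / 2"
      unfolding xe by (simp add: power2_eq_square field_simps)
    then show ?thesis
      using \<open>v > 0\<close> s1 by (simp only:) (simp add: x divide_simps power2_eq_square)
  qed
  finally show "- l * x + l\<^sup>2 * v\<^sup>2 / (2 * (1 - l * \<epsilon>))
      = - (x\<^sup>2 / (v\<^sup>2 * (1 + sqrt (1 + 2 * x * \<epsilon> / v\<^sup>2)) + x * \<epsilon>))"
    by (simp add: s_def)
qed

text \<open>Ville's argument with \<open>l\<close> left free. \<open>H k\<close> is built from the
  versions \<open>V\<close>, which are measurable for the preceding \<sigma>-field, so that
  \<open>H k\<close> belongs to \<open>F k\<close> and can be followed pathwise in an
  induction.\<close>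

lemma prob_maximal_le:
  fixes M :: "'a measure" and F :: "nat \<Rightarrow> 'a measure" and \<xi> :: "nat \<Rightarrow> 'a \<Rightarrow> real"
    and n :: nat and \<epsilon> x v l :: real
  defines "V \<equiv> \<lambda>i. nn_cond_exp M (F (i - 1)) (\<lambda>\<omega>. ennreal ((\<xi> i \<omega>)\<^sup>2))"
    and "f \<equiv> l\<^sup>2 / (2 * (1 - l * \<epsilon>))"
  defines "H \<equiv> \<lambda>k. {\<omega> \<in> space M. \<exists>j\<in>{1..k}. partial_sum \<xi> j \<omega> \<ge> x
    \<and> (\<Sum>i=1..j. V i \<omega>) \<le> ennreal (v\<^sup>2)}"
  assumes "prob_space M" and n: "n \<ge> 1"
    and smd: "supermartingale_differences M n F \<xi>"
    and \<epsilon>: "\<epsilon> > 0"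
    and moments: "\<And>k i. k \<ge> 2 \<Longrightarrow> i \<in> {1..n} \<Longrightarrow>
           AE \<omega> in M. ext_cond_exp M (F (i - 1)) (\<lambda>\<omega>. \<xi> i \<omega> ^ k) \<omega>
             \<le> ereal (1 / 2 * fact k * \<epsilon> ^ (k - 2))
               * ext_cond_exp M (F (i - 1)) (\<lambda>\<omega>. (\<xi> i \<omega>)\<^sup>2) \<omega>"
    and l: "l > 0" "l * \<epsilon> < 1"
  shows "H n \<in> sets M" "measure M (H n) \<le> exp (- l * x) * (1 + f * v\<^sup>2 / n) ^ n"
proof -
  interpret prob_space M by fact
  have f: "f > 0" using l by (simp add: f_def)

  \<comment> \<open>Filtration and measurability\<close>
  have subM: "subalgebra M (F i)" if "i \<le> n" for i
    using smd that by (auto simp: supermartingale_differences_def)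
  have F_mono: "sets (F i) \<subseteq> sets (F j)" if "i \<le> j" "j \<le> n" for i j
    using that
  proof (induction j rule: dec_induct)
    case (step k)
    then have "sets (F k) \<subseteq> sets (F (Suc k))"
      using smd by (auto simp: supermartingale_differences_def)
    with step show ?case by auto
  qed simp
  have subF: "subalgebra (F j) (F i)" if "i \<le> j" "j \<le> n" for i j
    using F_mono[OF that] subM[of i] subM[of j] that by (auto simp: subalgebra_def)
  have \<xi>_meas: "\<xi> i \<in> borel_measurable (F k)" if "i \<le> k" "k \<le> n" for i k
  proof (rule measurable_from_subalg[OF subF[OF that]])
    show "\<xi> i \<in> borel_measurable (F i)"
      using smd that by (simp add: supermartingale_differences_def)
  qed
  \<comment> \<open>The conditional second moments are predictable: \<open>V (Suc k)\<close> is
    known at time \<open>k\<close>, hence the bound \<open>i \<le> Suc k\<close> where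
    \<open>\<xi>_meas\<close> has \<open>i \<le> k\<close>.\<close>
  have V_meas: "V i \<in> borel_measurable (F k)" if "i \<le> Suc k" "k \<le> n" for i k
  proof (rule measurable_from_subalg[OF subF])
    show "V i \<in> borel_measurable (F (i - 1))" unfolding V_def by simp
  qed (use that in auto)
  have space_F: "space (F k) = space M" if "k \<le> n" for k
    using subM[OF that] by (simp add: subalgebra_def)
  have H_meas: "H k \<in> sets (F k)" if k: "k \<le> n" for k
  proof -
    have [measurable]: "partial_sum \<xi> j \<in> borel_measurable (F k)"
      "(\<lambda>\<omega>. \<Sum>i=1..j. V i \<omega>) \<in> borel_measurable (F k)" if "j \<in> {1..k}" for j
      unfolding partial_sum_def[abs_def] using that k
      by (auto intro!: borel_measurable_sum \<xi>_meas V_meas)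
    have "{\<omega> \<in> space (F k). \<exists>j\<in>{1..k}. partial_sum \<xi> j \<omega> \<ge> x
      \<and> (\<Sum>i=1..j. V i \<omega>) \<le> ennreal (v\<^sup>2)} \<in> sets (F k)"
      by measurable
    then show ?thesis using k by (simp add: H_def space_F)
  qed
  have H_M: "H k \<in> sets M" if "k \<le> n" for k
    using H_meas[OF that] subM[OF that] by (auto simp: subalgebra_def)
  then show "H n \<in> sets M" by simp

  \<comment> \<open>The normalised exponential process and its killing\<close>
  define I where "I k = {\<omega> \<in> space M. (\<Sum>i=1..k. V i \<omega>) \<le> ennreal (v\<^sup>2)}" for k
  have I_meas: "I (Suc k) \<in> sets (F k)" if k: "k \<le> n" for k
  proof -
    have [measurable]: "(\<lambda>\<omega>. \<Sum>i=1..Suc k. V i \<omega>) \<in> borel_measurable (F k)"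
      using k by (intro borel_measurable_sum V_meas) auto
    have "{\<omega> \<in> space (F k). (\<Sum>i=1..Suc k. V i \<omega>) \<le> ennreal (v\<^sup>2)} \<in> sets (F k)"
      by measurable
    then show ?thesis using k by (simp add: I_def space_F)
  qed
  \<comment> \<open>\<open>enn2real\<close> sends an infinite \<open>V i\<close> to 0, but
    \<open>P k\<close> is only used where \<open>V 1, ..., V k\<close> sum to at most
    \<open>v\<^sup>2\<close> and are therefore finite.\<close>
  define P where "P k \<omega> = (\<Prod>i=1..k. exp (l * \<xi> i \<omega>) / (1 + f * enn2real (V i \<omega>)))" for k \<omega>
  have P0: "P k \<omega> > 0" for k \<omega>
    unfolding P_def using f by (intro prod_pos divide_pos_pos) (auto intro: add_pos_nonneg)
  have P_meas: "P k \<in> borel_measurable (F k)" if k: "k \<le> n" for k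
  proof -
    have [measurable]: "\<xi> i \<in> borel_measurable (F k)" "V i \<in> borel_measurable (F k)" if "i \<in> {1..k}" for i
      using that k by (auto intro: \<xi>_meas V_meas)
    show ?thesis unfolding P_def[abs_def] by (intro borel_measurable_prod) measurable
  qed
  define m where "m = 1 + f * v\<^sup>2 / n"
  have m: "m > 0" using f by (auto simp: m_def intro: add_pos_nonneg)
  \<comment> \<open>The level that \<open>P k\<close> has reached when the event occurs at time
    \<open>k\<close>: the numerator is at least exp (l x), and the denominator at most
    \<open>m ^ n\<close> by AM-GM.\<close>
  define c where "c = exp (l * x) / m ^ n"
  have c0: "c > 0" using m by (simp add: c_def)
  have P_ge: "P k \<omega> \<ge> c" if "k \<le> n" "partial_sum \<xi> k \<omega> \<ge> x" "(\<Sum>i=1..k. V i \<omega>) \<le> ennreal (v\<^sup>2)" for k \<omega>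
  proof -
    have fin: "(\<Sum>i=1..k. V i \<omega>) < \<top>" by (rule order.strict_trans1[OF that(3)]) simp
    have "V i \<omega> < \<top>" if "i \<in> {1..k}" for i
      using that by (intro order.strict_trans1[OF member_le_sum fin]) auto
    then have "(\<Sum>i=1..k. enn2real (V i \<omega>)) = enn2real (\<Sum>i=1..k. V i \<omega>)"
      by (subst enn2real_sum) (simp_all add: comp_def)
    also have "\<dots> \<le> enn2real (ennreal (v\<^sup>2))" by (intro enn2real_mono that) simp
    finally have "(\<Sum>i=1..k. f * enn2real (V i \<omega>)) \<le> f * v\<^sup>2"
      using f by (simp flip: sum_distrib_left)
    then have "(\<Prod>i=1..k. 1 + f * enn2real (V i \<omega>)) \<le> m ^ n"
      unfolding m_def using that(1) n f by (intro prod_one_plus_le_power_mean) auto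
    moreover have "(\<Prod>i=1..k. 1 + f * enn2real (V i \<omega>)) > 0"
      using f by (intro prod_pos) (auto intro: add_pos_nonneg)
    moreover have "(\<Prod>i=1..k. exp (l * \<xi> i \<omega>)) = exp (l * partial_sum \<xi> k \<omega>)"
      by (simp add: exp_sum partial_sum_def sum_distrib_left)
    ultimately show ?thesis
      unfolding P_def c_def prod_dividef using that(2) l by (intro frac_le) auto
  qed
  \<comment> \<open>The process is killed when the variance budget is exceeded and also once the
    event has occurred.\<close>
  define G where "G k \<omega> = indicator (I k - H k) \<omega> * ennreal (P k \<omega>)" for k \<omega>
  have G_M: "G k \<in> borel_measurable M" if k: "k \<le> n" for k
  proof -
    have [measurable]: "I k \<in> sets M"
    proof (cases k)
      case (Suc j)
      then show ?thesis using I_meas[of j] subM[of j] k by (auto simp: subalgebra_def)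
    qed (simp add: I_def)
    have [measurable]: "P k \<in> borel_measurable M" "H k \<in> sets M"
      using k by (auto intro: measurable_from_subalg[OF subM P_meas] H_M)
    show ?thesis unfolding G_def[abs_def] by measurable
  qed
  \<comment> \<open>Ville's inequality in the form of an invariant: \<open>c\<close> times the probability of having hit plus
    the mass of the process that has not hit yet does not increase.\<close>
  have step: "ennreal c * emeasure M (H (Suc k)) + (\<integral>\<^sup>+\<omega>. G (Suc k) \<omega> \<partial>M)
    \<le> ennreal c * emeasure M (H k) + (\<integral>\<^sup>+\<omega>. G k \<omega> \<partial>M)"
    if k: "k < n" and fin: "(\<integral>\<^sup>+\<omega>. G k \<omega> \<partial>M) < \<infinity>" for k
  proof -

    \<comment> \<open>One step of the supermartingale\<close>
    interpret S: finite_measure_subalgebra M "F k"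
      using subM[of k] k by unfold_locales auto
    define U where "U = V (Suc k)"
    have U_eq: "U = nn_cond_exp M (F k) (\<lambda>\<omega>. ennreal ((\<xi> (Suc k) \<omega>)\<^sup>2))"
      by (simp add: U_def V_def)
    \<comment> \<open>The part of the next value \<open>P (Suc k)\<close> already known at time
      \<open>k\<close>: the new denominator and the restriction to \<open>I (Suc k)\<close> are
      predictable, so only exp (l \<xi>) remains to be averaged.\<close>
    define W where "W \<omega> = indicator (I (Suc k) - H k) \<omega> * ennreal (P k \<omega> / (1 + f * enn2real (U \<omega>)))" for \<omega>
    have W_meas: "W \<in> borel_measurable (F k)"
    proof -
      have [measurable]: "I (Suc k) \<in> sets (F k)" "H k \<in> sets (F k)"
        "P k \<in> borel_measurable (F k)" "U \<in> borel_measurable (F k)"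
        using k by (auto intro: I_meas H_meas P_meas V_meas simp: U_def)
      show ?thesis unfolding W_def by measurable
    qed
    have I_sub: "\<omega> \<in> I k" "U \<omega> \<le> ennreal (v\<^sup>2)" if "\<omega> \<in> I (Suc k)" for \<omega>
    proof -
      have "(\<Sum>i=1..k. V i \<omega>) + U \<omega> \<le> ennreal (v\<^sup>2)" using that by (simp add: I_def U_def)
      then have "(\<Sum>i=1..k. V i \<omega>) \<le> ennreal (v\<^sup>2)" "U \<omega> \<le> ennreal (v\<^sup>2)"
        by (meson order_trans add_increasing add_increasing2 order_refl zero_le)+
      then show "\<omega> \<in> I k" "U \<omega> \<le> ennreal (v\<^sup>2)" using that by (auto simp: I_def)
    qed
    have WG: "W \<omega> * (1 + ennreal f * U \<omega>) \<le> G k \<omega>" for \<omega>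
    proof (cases "\<omega> \<in> I (Suc k) - H k")
      case True
      then obtain u where u: "U \<omega> = ennreal u" "u \<ge> 0"
        using I_sub(2)[of \<omega>] by (metis DiffD1 ennreal_cases ennreal_neq_top top.extremum_uniqueI)
      have pos: "1 + f * u > 0" using f u by (auto intro: add_pos_nonneg)
      have "W \<omega> * (1 + ennreal f * U \<omega>) = ennreal (P k \<omega> / (1 + f * u)) * ennreal (1 + f * u)"
        using True u f by (simp add: W_def ennreal_mult)
      also have "\<dots> = ennreal (P k \<omega>)"
        using pos P0[of k \<omega>] by (subst ennreal_mult[symmetric]) (auto intro: less_imp_le)
      finally show ?thesis using True I_sub(1) by (simp add: G_def)
    qed (auto simp: W_def)
    have W_le: "W \<omega> \<le> G k \<omega>" for \<omega>
      using WG[of \<omega>] by (auto simp: distrib_left intro: order_trans[rotated])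
    \<comment> \<open>On the support of \<open>W\<close> the next conditional variance is at most
      \<open>v\<^sup>2\<close>. This supplies the finiteness of the weighted second moment without
      square integrability of \<xi>.\<close>
    have WU_le: "W \<omega> * U \<omega> \<le> ennreal (v\<^sup>2) * G k \<omega>" for \<omega>
    proof (cases "\<omega> \<in> I (Suc k) - H k")
      case True
      then show ?thesis using mult_mono[OF W_le I_sub(2)] by (simp add: mult.commute)
    qed (auto simp: W_def)
    have [measurable]: "W \<in> borel_measurable M" "\<xi> (Suc k) \<in> borel_measurable M"
      using k by (auto intro: measurable_from_subalg[OF subM W_meas]
          measurable_from_subalg[OF subM \<xi>_meas[of "Suc k" "Suc k"]])
    have [measurable]: "H k \<in> sets M" "H (Suc k) \<in> sets M"
      "G k \<in> borel_measurable M" "G (Suc k) \<in> borel_measurable M"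
      using k by (auto intro: H_M G_M)
    \<comment> \<open>Three cases: the event occurred earlier and \<open>W\<close> vanishes; it
      occurs now and \<open>P (Suc k)\<close> pays for the level \<open>c\<close>; or it has not
      occurred, and the surviving masses agree.\<close>
    have pw: "ennreal c * indicator (H (Suc k)) \<omega> + G (Suc k) \<omega>
      \<le> ennreal c * indicator (H k) \<omega> + W \<omega> * ennreal (exp (l * \<xi> (Suc k) \<omega>))" for \<omega>
    proof -
      have PS: "ennreal (P k \<omega> / (1 + f * enn2real (U \<omega>))) * ennreal (exp (l * \<xi> (Suc k) \<omega>))
        = ennreal (P (Suc k) \<omega>)"
        using P0[of k \<omega>] f by (subst ennreal_mult[symmetric]) (auto simp: P_def U_def)
      have H_Suc: "\<omega> \<in> H (Suc k) \<longleftrightarrow> \<omega> \<in> H k \<or> (\<omega> \<in> I (Suc k) \<and> partial_sum \<xi> (Suc k) \<omega> \<ge> x)"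
      proof -
        have "{1..Suc k} = insert (Suc k) {1..k}" by auto
        then have "(\<exists>j\<in>{1..Suc k}. Q j) \<longleftrightarrow> (\<exists>j\<in>{1..k}. Q j) \<or> Q (Suc k)" for Q
          by (metis insert_iff)
        then show ?thesis unfolding H_def I_def by blast
      qed
      consider "\<omega> \<in> H k" | "\<omega> \<notin> H k" "\<omega> \<in> I (Suc k)" "partial_sum \<xi> (Suc k) \<omega> \<ge> x"
        | "\<omega> \<notin> H (Suc k)" "\<omega> \<notin> H k" using H_Suc by blast
      then show ?thesis
      proof cases
        case 1 then show ?thesis by (simp add: H_Suc G_def)
      next
        case 2
        then have "c \<le> P (Suc k) \<omega>" using k by (intro P_ge) (auto simp: I_def)
        with 2 show ?thesis by (simp add: H_Suc G_def W_def PS ennreal_leI)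
      next
        case 3
        then show ?thesis by (simp add: G_def W_def PS indicator_def)
      qed
    qed
    have "ennreal c * emeasure M (H (Suc k)) + (\<integral>\<^sup>+\<omega>. G (Suc k) \<omega> \<partial>M)
      = (\<integral>\<^sup>+\<omega>. ennreal c * indicator (H (Suc k)) \<omega> + G (Suc k) \<omega> \<partial>M)"
      by (subst nn_integral_add) (auto simp: nn_integral_cmult)
    also have "\<dots> \<le> (\<integral>\<^sup>+\<omega>. ennreal c * indicator (H k) \<omega> + W \<omega> * ennreal (exp (l * \<xi> (Suc k) \<omega>)) \<partial>M)"
      by (intro nn_integral_mono pw)
    also have "\<dots> = ennreal c * emeasure M (H k) + (\<integral>\<^sup>+\<omega>. W \<omega> * ennreal (exp (l * \<xi> (Suc k) \<omega>)) \<partial>M)"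
      by (subst nn_integral_add) (auto simp: nn_integral_cmult)
    also have "(\<integral>\<^sup>+\<omega>. W \<omega> * ennreal (exp (l * \<xi> (Suc k) \<omega>)) \<partial>M)
      \<le> (\<integral>\<^sup>+\<omega>. W \<omega> * (1 + ennreal f * U \<omega>) \<partial>M)"
      unfolding f_def U_eq
    proof (rule S.nn_integral_exp_le_of_cond_moments)
      show "integrable M (\<xi> (Suc k))" "AE \<omega> in M. real_cond_exp M (F k) (\<xi> (Suc k)) \<omega> \<le> 0"
        using smd k unfolding supermartingale_differences_def
        by (auto dest!: bspec[of _ _ "Suc k"])
      show "(\<integral>\<^sup>+\<omega>. W \<omega> \<partial>M) < \<infinity>"
        using fin by (rule order.strict_trans1[OF nn_integral_mono[OF W_le]])
      have "(\<integral>\<^sup>+\<omega>. W \<omega> * U \<omega> \<partial>M) \<le> (\<integral>\<^sup>+\<omega>. ennreal (v\<^sup>2) * G k \<omega> \<partial>M)"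
        by (intro nn_integral_mono WU_le)
      also have "\<dots> < \<infinity>" using fin by (simp add: nn_integral_cmult ennreal_mult_less_top)
      finally show "(\<integral>\<^sup>+\<omega>. W \<omega> * nn_cond_exp M (F k) (\<lambda>\<omega>. ennreal ((\<xi> (Suc k) \<omega>)\<^sup>2)) \<omega> \<partial>M) < \<infinity>"
        by (simp add: U_eq)
    qed (use \<epsilon> l W_meas moments[of _ "Suc k"] k in simp_all)
    also have "\<dots> \<le> (\<integral>\<^sup>+\<omega>. G k \<omega> \<partial>M)" by (intro nn_integral_mono WG)
    finally show ?thesis by (simp add: add_left_mono)
  qed

  \<comment> \<open>Induction over time\<close>
  have "ennreal c * emeasure M (H k) + (\<integral>\<^sup>+\<omega>. G k \<omega> \<partial>M) \<le> 1" if "k \<le> n" for k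
    using that
  proof (induction k)
    case 0
    \<comment> \<open>Empty sums and products give budget 0 and \<open>P 0 = 1\<close>, so the
      invariant starts at the total mass 1.\<close>
    have "H 0 = {}" "G 0 = indicator (space M)"
      by (auto simp: H_def G_def I_def P_def fun_eq_iff indicator_def)
    then show ?case by (simp add: emeasure_space_1)
  next
    case (Suc k)
    then have IH: "ennreal c * emeasure M (H k) + (\<integral>\<^sup>+\<omega>. G k \<omega> \<partial>M) \<le> 1" by simp
    \<comment> \<open>The invariant also provides the finiteness that the next step
      requires.\<close>
    then have "(\<integral>\<^sup>+\<omega>. G k \<omega> \<partial>M) \<le> 1" by (rule order_trans[rotated]) simp
    then have "(\<integral>\<^sup>+\<omega>. G k \<omega> \<partial>M) < \<infinity>" by (simp add: order.strict_trans1)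
    from step[OF _ this] Suc.prems IH show ?case by (meson Suc_le_lessD order_trans)
  qed
  from this[OF order_refl] have "ennreal c * emeasure M (H n) \<le> 1"
    by (rule order_trans[OF add_increasing2[OF zero_le order_refl]])
  then have "ennreal (c * prob (H n)) \<le> ennreal 1"
    using c0 by (simp add: emeasure_eq_measure ennreal_mult)
  then have "c * prob (H n) \<le> 1" by (subst (asm) ennreal_le_iff) auto
  then show "measure M (H n) \<le> exp (- l * x) * (1 + f * v\<^sup>2 / n) ^ n"
    using m unfolding m_def[symmetric] c_def by (simp add: exp_minus field_simps)
qed

theorem corollary2p4:
  fixes M :: "'a measure" and F :: "nat \<Rightarrow> 'a measure" and \<xi> :: "nat \<Rightarrow> 'a \<Rightarrow> real"
    and n :: nat and \<epsilon> x v :: real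
  assumes "prob_space M"
    and "n \<ge> 1"
    and "supermartingale_differences M n F \<xi>"
    and "\<epsilon> > 0"
    and "\<And>l i. l \<ge> 2 \<Longrightarrow> i \<in> {1..n} \<Longrightarrow>
           AE \<omega> in M. ext_cond_exp M (F (i - 1)) (\<lambda>\<omega>. \<xi> i \<omega> ^ l) \<omega>
             \<le> ereal (1 / 2 * fact l * \<epsilon> ^ (l - 2))
               * ext_cond_exp M (F (i - 1)) (\<lambda>\<omega>. (\<xi> i \<omega>)\<^sup>2) \<omega>"
    and "x > 0" and "v > 0"
  shows "measure M {\<omega> \<in> space M. \<exists>k\<in>{1..n}. partial_sum \<xi> k \<omega> \<ge> x
            \<and> quadratic_characteristic M F \<xi> k \<omega> \<le> ereal (v\<^sup>2)} \<le> B1n n x \<epsilon> v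
       \<and> B1n n x \<epsilon> v \<le> B1 x \<epsilon> v
       \<and> lambda_bar x \<epsilon> v \<in> {0<..<1 / \<epsilon>}"
proof (intro conjI)
  interpret prob_space M by fact
  define l where "l = lambda_bar x \<epsilon> v"
  note l = lambda_bar_bounds_and_exponent[OF \<open>x > 0\<close> \<open>\<epsilon> > 0\<close> \<open>v > 0\<close>, folded l_def]
  from l(1,2) \<open>\<epsilon> > 0\<close> show "lambda_bar x \<epsilon> v \<in> {0<..<1 / \<epsilon>}"
    by (simp add: l_def[symmetric] field_simps)
  define y where "y = l\<^sup>2 * v\<^sup>2 / (2 * (1 - l * \<epsilon>))"
  have y: "y > 0" using l \<open>v > 0\<close> by (simp add: y_def)
  have B1n: "B1n n x \<epsilon> v = exp (- l * x + real n * ln (1 + y / n))"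
    by (simp add: B1n_def Let_def l_def[symmetric] y_def mult.commute mult.left_commute)
  \<comment> \<open>ln (1 + t) \<le> t at t = y / n removes the dependence on
    \<open>n\<close>.\<close>
  have "real n * ln (1 + y / n) \<le> n * (y / n)"
    using y by (intro mult_left_mono ln_add_one_self_le_self) auto
  then have "real n * ln (1 + y / n) \<le> y" using \<open>n \<ge> 1\<close> by simp
  then show "B1n n x \<epsilon> v \<le> B1 x \<epsilon> v"
    unfolding B1n B1_def l(3)[symmetric] y_def[symmetric] by simp
  define V where "V i = nn_cond_exp M (F (i - 1)) (\<lambda>\<omega>. ennreal ((\<xi> i \<omega>)\<^sup>2))" for i
  define H where "H = {\<omega> \<in> space M. \<exists>j\<in>{1..n}. partial_sum \<xi> j \<omega> \<ge> x
    \<and> (\<Sum>i=1..j. V i \<omega>) \<le> ennreal (v\<^sup>2)}"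
  note H = prob_maximal_le[OF assms(1-5) l(1,2), of x v, folded V_def, folded H_def]
  \<comment> \<open>\<open>ext_cond_exp\<close> subtracts the conditional expectation of the zero
    function, which vanishes almost everywhere; the quadratic characteristic thus agrees with the
    sums of \<open>V\<close> off a null set.\<close>
  have "AE \<omega> in M. ext_cond_exp M (F (i - 1)) (\<lambda>\<omega>. (\<xi> i \<omega>)\<^sup>2) \<omega> = enn2ereal (V i \<omega>)"
    if i: "i \<in> {1..n}" for i
  proof -
    from assms(3) i have "subalgebra M (F (i - 1))" "integrable M (\<xi> i)"
      by (auto simp: supermartingale_differences_def)
    then interpret finite_measure_subalgebra M "F (i - 1)" by unfold_locales
    show ?thesis unfolding V_def using \<open>integrable M (\<xi> i)\<close> by (intro ext_cond_exp_nonneg) auto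
  qed
  then have "AE \<omega> in M. \<forall>i\<in>{1..n}. ext_cond_exp M (F (i - 1)) (\<lambda>\<omega>. (\<xi> i \<omega>)\<^sup>2) \<omega> = enn2ereal (V i \<omega>)"
    by (intro AE_finite_allI) auto
  then have "AE \<omega> in M. \<omega> \<in> {\<omega> \<in> space M. \<exists>k\<in>{1..n}. partial_sum \<xi> k \<omega> \<ge> x
            \<and> quadratic_characteristic M F \<xi> k \<omega> \<le> ereal (v\<^sup>2)} \<longrightarrow> \<omega> \<in> H"
  proof eventually_elim
    case (elim \<omega>)
    have "quadratic_characteristic M F \<xi> k \<omega> = enn2ereal (\<Sum>i=1..k. V i \<omega>)" if "k \<in> {1..n}" for k
    proof -
      have "quadratic_characteristic M F \<xi> k \<omega> = (\<Sum>i=1..k. enn2ereal (V i \<omega>))"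
        unfolding quadratic_characteristic_def using elim that by (intro sum.cong) auto
      also have "\<dots> = enn2ereal (\<Sum>i=1..k. V i \<omega>)"
        by (simp add: sum_enn2ereal)
      finally show ?thesis .
    qed
    moreover have "w \<le> ennreal (v\<^sup>2)" if "enn2ereal w \<le> ereal (v\<^sup>2)" for w
      using that by (simp add: less_eq_ennreal.rep_eq enn2ereal_ennreal)
    ultimately show ?case unfolding H_def by fastforce
  qed
  \<comment> \<open>Almost sure inclusion suffices because the larger set \<open>H\<close> is known
    to be measurable.\<close>
  then have "measure M {\<omega> \<in> space M. \<exists>k\<in>{1..n}. partial_sum \<xi> k \<omega> \<ge> x
            \<and> quadratic_characteristic M F \<xi> k \<omega> \<le> ereal (v\<^sup>2)} \<le> measure M H"
    unfolding measure_def by (intro enn2real_mono emeasure_mono_AE H(1)) (auto simp: less_top[symmetric])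
  also have "\<dots> \<le> exp (- l * x) * (1 + y / n) ^ n"
    using H(2) by (simp add: y_def)
  also have "\<dots> = B1n n x \<epsilon> v"
    using y unfolding B1n exp_add by (simp add: exp_of_nat_mult add_pos_nonneg)
  finally show "measure M {\<omega> \<in> space M. \<exists>k\<in>{1..n}. partial_sum \<xi> k \<omega> \<ge> x
            \<and> quadratic_characteristic M F \<xi> k \<omega> \<le> ereal (v\<^sup>2)} \<le> B1n n x \<epsilon> v" .
qed

end
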